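(* Let $\mathcal{A}_0=(V,\mu_0,\alpha_0)$ be a commutative Hom-associative algebra over $\mathbb{K}$ and let $\mathcal{A}_t=(V,\mu_t,\alpha_t)$, with $\mu_t=\sum_{i\ge 0}\mu_i t^i$ and $\alpha_t=\sum_{i\ge 0}\alpha_i t^i$, be a formal Hom-associative deformation of $\mathcal{A}_0$. Define a bracket on $V$ by $\{x,y\}=\mu_1(x,y)-\mu_1(y,x)$ for $x,y\in V$, where $\mu_1$ is the first order term of $\mu_t$. Then $(V,\mu_0,\{\cdot,\cdot\},\alpha_0)$ is a Hom-Poisson algebra.
   Context: $\mathbb{K}$ is an algebraically closed field of characteristic $0$ and $V$ is a vector space over $\mathbb{K}$. A Hom-associative algebra is a triple $(V,\mu,\alpha)$ with $\mu:V\times V\to V$ bilinear and $\alpha:V\to V$ linear such that $\mu(\alpha(x),\mu(y,z))=\mu(\mu(x,y),\alpha(z))$ for all $x,y,z\in V$. It is commutative if $\mu(x,y)=\mu(y,x)$ for all $x,y$. A Hom-Lie algebra is a triple $(V,[\cdot,\cdot],\alpha)$ with $[\cdot,\cdot]:V\times V\to V$ bilinear and $\alpha:V\to V$ linear such that $[x,y]=-[y,x]$ and $[\alpha(x),[y,z]]+[\alpha(y),[z,x]]+[\alpha(z),[x,y]]=0$ for all $x,y,z\in V$. A Hom-Poisson algebra is a quadruple $(V,\mu,\{\cdot,\cdot\},\alpha)$ such that (1) $(V,\mu,\alpha)$ is a commutative Hom-associative algebra; (2) $(V,\{\cdot,\cdot\},\alpha)$ is a Hom-Lie algebra; (3) $\{\alpha(x),\mu(y,z)\}=\mu(\alpha(y),\{x,z\})+\mu(\alpha(z),\{x,y\})$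 for all $x,y,z\in V$. $V[[t]]$ denotes the formal power series in $t$ with coefficients in $V$; bilinear and linear maps on $V$ are extended $\mathbb{K}[[t]]$-(bi)linearly (coefficientwise) to $V[[t]]$. A formal Hom-associative deformation of a Hom-associative algebra $(V,\mu_0,\alpha_0)$ is given by maps $\mu_t=\sum_{i\ge 0}\mu_i t^i: V[[t]]\times V[[t]]\to V[[t]]$ and $\alpha_t=\sum_{i\ge 0}\alpha_i t^i:V[[t]]\to V[[t]]$, where each $\mu_i:V\times V\to V$ is $\mathbb{K}$-bilinear and each $\alpha_i:V\to V$ is $\mathbb{K}$-linear (extended to $V[[t]]$), the terms of index $0$ being the given $\mu_0,\alpha_0$, such that $\mu_t(\alpha_t(x),\mu_t(y,z))-\mu_t(\mu_t(x,y),\alpha_t(z))=0$ for all $x,y,z\in V$. *)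

theory Defs
  imports "HOL-Computational_Algebra.Computational_Algebra"
begin

unbundle fps_syntax

definition bilinear_map ::
  "('k::field \<Rightarrow> 'v::ab_group_add \<Rightarrow> 'v) \<Rightarrow> ('v \<Rightarrow> 'v \<Rightarrow> 'v) \<Rightarrow> bool" where
  "bilinear_map scale m \<longleftrightarrow>
     (\<forall>x. Vector_Spaces.linear scale scale (\<lambda>y. m x y)) \<and>
     (\<forall>y. Vector_Spaces.linear scale scale (\<lambda>x. m x y))"

locale hom_associative_algebra = vector_space scale
  for scale :: "'k::field \<Rightarrow> 'v::ab_group_add \<Rightarrow> 'v"
    and \<mu> :: "'v \<Rightarrow> 'v \<Rightarrow> 'v" and \<alpha> :: "'v \<Rightarrow> 'v" +
  assumes bilinear_mult: "bilinear_map scale \<mu>"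
    and linear_twist: "Vector_Spaces.linear scale scale \<alpha>"
    and hom_assoc: "\<mu> (\<alpha> x) (\<mu> y z) = \<mu> (\<mu> x y) (\<alpha> z)"

locale commutative_hom_associative_algebra = hom_associative_algebra scale \<mu> \<alpha>
  for scale :: "'k::field \<Rightarrow> 'v::ab_group_add \<Rightarrow> 'v"
    and \<mu> :: "'v \<Rightarrow> 'v \<Rightarrow> 'v" and \<alpha> :: "'v \<Rightarrow> 'v" +
  assumes mult_commute: "\<mu> x y = \<mu> y x"

locale hom_Lie_algebra = vector_space scale
  for scale :: "'k::field \<Rightarrow> 'v::ab_group_add \<Rightarrow> 'v"
    and br :: "'v \<Rightarrow> 'v \<Rightarrow> 'v" and \<alpha> :: "'v \<Rightarrow> 'v" +
  assumes bilinear_bracket: "bilinear_map scale br"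
    and linear_twist: "Vector_Spaces.linear scale scale \<alpha>"
    and skew_symmetric: "br x y = - br y x"
    and hom_Jacobi: "br (\<alpha> x) (br y z) + br (\<alpha> y) (br z x) + br (\<alpha> z) (br x y) = 0"

locale hom_Poisson_algebra =
  commutative: commutative_hom_associative_algebra scale \<mu> \<alpha> +
  Lie: hom_Lie_algebra scale br \<alpha>
  for scale :: "'k::field \<Rightarrow> 'v::ab_group_add \<Rightarrow> 'v"
    and \<mu> :: "'v \<Rightarrow> 'v \<Rightarrow> 'v" and br :: "'v \<Rightarrow> 'v \<Rightarrow> 'v" and \<alpha> :: "'v \<Rightarrow> 'v" +
  assumes hom_Leibniz: "br (\<alpha> x) (\<mu> y z) = \<mu> (\<alpha> y) (br x z) + \<mu> (\<alpha> z) (br x y)"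

text \<open>
  The space \<open>V[[t]]\<close> is the type \<^typ>\<open>'v fps\<close>; an element of \<open>V\<close> is embedded as a
  constant series by \<^const>\<open>fps_const\<close>. Linear and bilinear maps on \<open>V\<close> are extended
  coefficientwise, the bilinear ones by the Cauchy product.
\<close>

definition fps_extend_linear :: "('v \<Rightarrow> 'v) \<Rightarrow> 'v fps \<Rightarrow> 'v fps" where
  "fps_extend_linear a f = Abs_fps (\<lambda>n. a (f $ n))"

definition fps_extend_bilinear ::
  "('v::ab_group_add \<Rightarrow> 'v \<Rightarrow> 'v) \<Rightarrow> 'v fps \<Rightarrow> 'v fps \<Rightarrow> 'v fps" where
  "fps_extend_bilinear m f g = Abs_fps (\<lambda>n. \<Sum>j\<le>n. m (f $ j) (g $ (n - j)))"

text \<open>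
  The \<open>t\<close>-adically convergent sum \<open>\<Sum>i. F i * t ^ i\<close> of a sequence \<open>F\<close> in \<open>V[[t]]\<close>:
  the summand of index \<open>i\<close> contributes to the coefficient of \<open>t ^ n\<close> its own coefficient
  of index \<open>n - i\<close>.
\<close>

definition t_series :: "(nat \<Rightarrow> 'v::ab_group_add fps) \<Rightarrow> 'v fps" where
  "t_series F = Abs_fps (\<lambda>n. \<Sum>i\<le>n. F i $ (n - i))"

definition formal_linear :: "(nat \<Rightarrow> 'v \<Rightarrow> 'v) \<Rightarrow> 'v::ab_group_add fps \<Rightarrow> 'v fps" where
  "formal_linear \<alpha> f = t_series (\<lambda>i. fps_extend_linear (\<alpha> i) f)"

definition formal_bilinear ::
  "(nat \<Rightarrow> 'v \<Rightarrow> 'v \<Rightarrow> 'v) \<Rightarrow> 'v::ab_group_add fps \<Rightarrow> 'v fps \<Rightarrow> 'v fps" where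
  "formal_bilinear \<mu> f g = t_series (\<lambda>i. fps_extend_bilinear (\<mu> i) f g)"

locale formal_hom_associative_deformation =
  hom_associative_algebra scale \<mu>\<^sub>0 \<alpha>\<^sub>0
  for scale :: "'k::field \<Rightarrow> 'v::ab_group_add \<Rightarrow> 'v"
    and \<mu>\<^sub>0 :: "'v \<Rightarrow> 'v \<Rightarrow> 'v" and \<alpha>\<^sub>0 :: "'v \<Rightarrow> 'v"
    and \<mu> :: "nat \<Rightarrow> 'v \<Rightarrow> 'v \<Rightarrow> 'v" and \<alpha> :: "nat \<Rightarrow> 'v \<Rightarrow> 'v" +
  assumes mult_0: "\<mu> 0 = \<mu>\<^sub>0"
    and twist_0: "\<alpha> 0 = \<alpha>\<^sub>0"
    and bilinear_mult_term: "bilinear_map scale (\<mu> i)"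
    and linear_twist_term: "Vector_Spaces.linear scale scale (\<alpha> i)"
    and deformation_equation:
      "formal_bilinear \<mu> (formal_linear \<alpha> (fps_const x))
                         (formal_bilinear \<mu> (fps_const y) (fps_const z))
       - formal_bilinear \<mu> (formal_bilinear \<mu> (fps_const x) (fps_const y))
                           (formal_linear \<alpha> (fps_const z)) = 0"

end

theory Submission
  imports Defs
begin

text \<open>
  Expanding the deformation equation in powers of \<open>t\<close> gives, for every \<open>n\<close>, an identity between
  sums over \<open>i + j + k = n\<close> of terms \<open>\<mu> i (\<alpha> j x) (\<mu> k y z)\<close> and \<open>\<mu> i (\<mu> j x y) (\<alpha> k z)\<close>
  (lemma \<open>deformation_coefficient\<close>). Let \<open>A\<^sub>n x y z\<close> be the difference of the two sums. The
  identities for the bracket are combinations of \<open>A\<^sub>1 = 0\<close> and \<open>A\<^sub>2 = 0\<close>.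

  The alternating combination \<open>A\<^sub>1 x y z - A\<^sub>1 y x z + A\<^sub>1 y z x\<close> is the defect of the
  Hom-Leibniz rule (lemma \<open>commutator_hom_Leibniz\<close>), and the signed sum of \<open>A\<^sub>2\<close> over all
  permutations of \<open>x, y, z\<close> is the Hom-Jacobi sum (lemma \<open>commutator_hom_Jacobi\<close>): in both cases
  commutativity of \<open>\<mu>\<^sub>0\<close> cancels every term that does not belong to the bracket identity, in
  particular those with \<open>\<mu> 2\<close>, \<open>\<alpha> 1\<close> or \<open>\<alpha> 2\<close>, so that only the commutator of \<open>\<mu> 1\<close>, the
  product \<open>\<mu>\<^sub>0\<close> and the twist \<open>\<alpha>\<^sub>0\<close> remain.
\<close>

lemma formal_linear_nth:
  "formal_linear \<alpha> f $ n = (\<Sum>i\<le>n. \<alpha> i (f $ (n - i)))"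
  by (simp add: formal_linear_def t_series_def fps_extend_linear_def)

lemma formal_bilinear_nth:
  "formal_bilinear \<mu> f g $ n = (\<Sum>i\<le>n. \<Sum>j\<le>n - i. \<mu> i (f $ j) (g $ (n - i - j)))"
  by (simp add: formal_bilinear_def t_series_def fps_extend_bilinear_def)

text \<open>
  On constant series only the summand whose coefficient index is \<open>0\<close> survives, so the values of
  \<open>\<alpha>\<^sub>t\<close> and \<open>\<mu>\<^sub>t\<close> on elements of \<open>V\<close> have the terms of \<open>\<alpha>\<close> and \<open>\<mu>\<close> as their coefficients.
\<close>

lemma formal_linear_fps_const_nth:
  assumes "\<And>i. \<alpha> i 0 = 0"
  shows "formal_linear \<alpha> (fps_const x) $ n = \<alpha> n x"
proof -
  have "formal_linear \<alpha> (fps_const x) $ n = (\<Sum>i\<le>n. if i = n then \<alpha> i x else 0)"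
    unfolding formal_linear_nth by (rule sum.cong) (auto simp: assms)
  then show ?thesis by simp
qed

lemma formal_bilinear_fps_const_nth:
  assumes "\<And>i x. \<mu> i x 0 = 0" and "\<And>i y. \<mu> i 0 y = 0"
  shows "formal_bilinear \<mu> (fps_const x) (fps_const y) $ n = \<mu> n x y"
proof -
  have "(\<Sum>j\<le>n - i. \<mu> i (fps_const x $ j) (fps_const y $ (n - i - j)))
      = (if i = n then \<mu> i x y else 0)" if "i \<le> n" for i
  proof -
    have "(\<Sum>j\<le>n - i. \<mu> i (fps_const x $ j) (fps_const y $ (n - i - j)))
        = (\<Sum>j\<le>n - i. if j = 0 then \<mu> i x (fps_const y $ (n - i)) else 0)"
      by (rule sum.cong) (auto simp: assms)
    with that show ?thesis by (auto simp: assms)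
  qed
  then have "formal_bilinear \<mu> (fps_const x) (fps_const y) $ n
      = (\<Sum>i\<le>n. if i = n then \<mu> i x y else 0)"
    unfolding formal_bilinear_nth by (intro sum.cong) auto
  then show ?thesis by simp
qed

lemma bilinear_map_simps:
  assumes "bilinear_map scale m"
  shows "m (x - y) z = m x z - m y z" and "m x (y - z) = m x y - m x z"
    and "m 0 z = 0" and "m x 0 = 0"
proof -
  interpret left: Vector_Spaces.linear scale scale "\<lambda>x. m x z" for z
    using assms by (simp add: bilinear_map_def)
  interpret right: Vector_Spaces.linear scale scale "m x" for x
    using assms by (simp add: bilinear_map_def)
  show "m (x - y) z = m x z - m y z" "m x (y - z) = m x y - m x z" "m 0 z = 0" "m x 0 = 0"
    by (rule left.diff right.diff left.zero right.zero)+
qed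

lemma (in vector_space) bilinear_map_commutator:
  assumes "bilinear_map scale m"
  shows "bilinear_map scale (\<lambda>x y. m x y - m y x)"
proof -
  interpret vector_space_pair scale scale ..
  show ?thesis
    using assms by (auto simp: bilinear_map_def intro: linear_compose_sub)
qed

context formal_hom_associative_deformation
begin

lemma deformation_coefficient:
  "(\<Sum>i\<le>n. \<Sum>j\<le>n - i. \<mu> i (\<alpha> j x) (\<mu> (n - i - j) y z) - \<mu> i (\<mu> j x y) (\<alpha> (n - i - j) z)) = 0"
proof -
  have \<alpha>_zero: "\<alpha> i 0 = 0" for i
  proof -
    interpret Vector_Spaces.linear scale scale "\<alpha> i" by (rule linear_twist_term)
    show ?thesis by (rule zero)
  qed
  note \<mu>_zero = bilinear_map_simps(3,4)[OF bilinear_mult_term]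
  note eq = arg_cong[OF deformation_equation[of x y z], of "\<lambda>f. f $ n"]
  show ?thesis
    using eq
    by (simp add: formal_bilinear_nth[of _ "formal_linear _ _"]
        formal_bilinear_nth[of _ _ "formal_linear _ _"] formal_linear_fps_const_nth
        formal_bilinear_fps_const_nth \<alpha>_zero \<mu>_zero sum_subtractf)
qed

lemmas mult_simps = bilinear_map_simps[OF bilinear_mult_term]

lemma deformation_equation_order_1:
  "\<mu> 1 (\<alpha> 0 x) (\<mu> 0 y z) + \<mu> 0 (\<alpha> 1 x) (\<mu> 0 y z) + \<mu> 0 (\<alpha> 0 x) (\<mu> 1 y z)
   - \<mu> 1 (\<mu> 0 x y) (\<alpha> 0 z) - \<mu> 0 (\<mu> 1 x y) (\<alpha> 0 z) - \<mu> 0 (\<mu> 0 x y) (\<alpha> 1 z) = 0"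
  using deformation_coefficient[where n = 1 and x = x and y = y and z = z] by (simp add: algebra_simps)

lemma deformation_equation_order_2:
  "\<mu> 2 (\<alpha> 0 x) (\<mu> 0 y z) + \<mu> 0 (\<alpha> 2 x) (\<mu> 0 y z) + \<mu> 0 (\<alpha> 0 x) (\<mu> 2 y z)
   + \<mu> 1 (\<alpha> 1 x) (\<mu> 0 y z) + \<mu> 1 (\<alpha> 0 x) (\<mu> 1 y z) + \<mu> 0 (\<alpha> 1 x) (\<mu> 1 y z)
   - \<mu> 2 (\<mu> 0 x y) (\<alpha> 0 z) - \<mu> 0 (\<mu> 2 x y) (\<alpha> 0 z) - \<mu> 0 (\<mu> 0 x y) (\<alpha> 2 z)
   - \<mu> 1 (\<mu> 1 x y) (\<alpha> 0 z) - \<mu> 1 (\<mu> 0 x y) (\<alpha> 1 z) - \<mu> 0 (\<mu> 1 x y) (\<alpha> 1 z) = 0"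
  using deformation_coefficient[where n = 2 and x = x and y = y and z = z]
  by (simp add: atMost_Suc numeral_2_eq_2 algebra_simps)

text \<open>
  In \<open>A x y z - A y x z + A y z x\<close>, the only terms with outer product \<open>\<mu> 1\<close> that survive are
  \<open>\<mu> 1 (\<alpha> 0 x) (\<mu> 0 y z)\<close> and \<open>- \<mu> 1 (\<mu> 0 y z) (\<alpha> 0 x)\<close>, which form the left-hand side. The
  terms containing \<open>\<alpha> 1\<close> cancel by commutativity of \<open>\<mu> 0\<close>, and so do those in which \<open>\<mu> 0\<close>
  multiplies \<open>\<alpha> 0 x\<close>; the others are the negated right-hand side.
\<close>

lemma commutator_hom_Leibniz:
  assumes comm: "\<And>x y. \<mu> 0 x y = \<mu> 0 y x"
  shows "\<mu> 1 (\<alpha> 0 x) (\<mu> 0 y z) - \<mu> 1 (\<mu> 0 y z) (\<alpha> 0 x)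
       = \<mu> 0 (\<alpha> 0 y) (\<mu> 1 x z - \<mu> 1 z x) + \<mu> 0 (\<alpha> 0 z) (\<mu> 1 x y - \<mu> 1 y x)"
proof -
  define A where "A x y z =
    \<mu> 1 (\<alpha> 0 x) (\<mu> 0 y z) + \<mu> 0 (\<alpha> 1 x) (\<mu> 0 y z) + \<mu> 0 (\<alpha> 0 x) (\<mu> 1 y z)
    - \<mu> 1 (\<mu> 0 x y) (\<alpha> 0 z) - \<mu> 0 (\<mu> 1 x y) (\<alpha> 0 z) - \<mu> 0 (\<mu> 0 x y) (\<alpha> 1 z)" for x y z
  have "\<mu> 1 (\<alpha> 0 x) (\<mu> 0 y z) - \<mu> 1 (\<mu> 0 y z) (\<alpha> 0 x)
      - (\<mu> 0 (\<alpha> 0 y) (\<mu> 1 x z - \<mu> 1 z x) + \<mu> 0 (\<alpha> 0 z) (\<mu> 1 x y - \<mu> 1 y x))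
      = A x y z - A y x z + A y z x"
    by (simp add: A_def mult_simps comm algebra_simps)
  also have "\<dots> = 0"
    using deformation_equation_order_1 by (simp add: A_def)
  finally show ?thesis by simp
qed

text \<open>
  In the signed sum of \<open>A\<close> over all permutations, a term with inner product \<open>\<mu> 0\<close> is symmetric in
  two arguments and is killed. The terms with outer product \<open>\<mu> 0\<close> and inner product \<open>\<mu> 1\<close> or
  \<open>\<mu> 2\<close> occur once for each bracketing, with opposite signs; commutativity of \<open>\<mu> 0\<close> and a cyclic
  permutation, which is even, carry one into the other. What remains are the two bracketings of
  \<open>\<mu> 1\<close> with itself, twisted by \<open>\<alpha> 0\<close>; their signed sum is the expanded Hom-Jacobi sum.
\<close>

lemma commutator_hom_Jacobi:
  fixes br :: "'v \<Rightarrow> 'v \<Rightarrow> 'v"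
  defines "br \<equiv> \<lambda>x y. \<mu> 1 x y - \<mu> 1 y x"
  assumes comm: "\<And>x y. \<mu> 0 x y = \<mu> 0 y x"
  shows "br (\<alpha> 0 x) (br y z) + br (\<alpha> 0 y) (br z x) + br (\<alpha> 0 z) (br x y) = 0"
proof -
  define A where "A x y z =
    \<mu> 2 (\<alpha> 0 x) (\<mu> 0 y z) + \<mu> 0 (\<alpha> 2 x) (\<mu> 0 y z) + \<mu> 0 (\<alpha> 0 x) (\<mu> 2 y z)
    + \<mu> 1 (\<alpha> 1 x) (\<mu> 0 y z) + \<mu> 1 (\<alpha> 0 x) (\<mu> 1 y z) + \<mu> 0 (\<alpha> 1 x) (\<mu> 1 y z)
    - \<mu> 2 (\<mu> 0 x y) (\<alpha> 0 z) - \<mu> 0 (\<mu> 2 x y) (\<alpha> 0 z) - \<mu> 0 (\<mu> 0 x y) (\<alpha> 2 z)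
    - \<mu> 1 (\<mu> 1 x y) (\<alpha> 0 z) - \<mu> 1 (\<mu> 0 x y) (\<alpha> 1 z) - \<mu> 0 (\<mu> 1 x y) (\<alpha> 1 z)" for x y z
  have "br (\<alpha> 0 x) (br y z) + br (\<alpha> 0 y) (br z x) + br (\<alpha> 0 z) (br x y)
      = A x y z + A y z x + A z x y - A y x z - A x z y - A z y x"
    by (simp add: A_def br_def mult_simps comm algebra_simps)
  also have "\<dots> = 0"
    using deformation_equation_order_2 by (simp add: A_def)
  finally show ?thesis .
qed

end

theorem theorem4p9:
  fixes scale :: "'k::{alg_closed_field, field_char_0} \<Rightarrow> 'v::ab_group_add \<Rightarrow> 'v"
    and \<mu>\<^sub>0 :: "'v \<Rightarrow> 'v \<Rightarrow> 'v" and \<alpha>\<^sub>0 :: "'v \<Rightarrow> 'v"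
    and \<mu> :: "nat \<Rightarrow> 'v \<Rightarrow> 'v \<Rightarrow> 'v" and \<alpha> :: "nat \<Rightarrow> 'v \<Rightarrow> 'v"
  assumes "commutative_hom_associative_algebra scale \<mu>\<^sub>0 \<alpha>\<^sub>0"
    and "formal_hom_associative_deformation scale \<mu>\<^sub>0 \<alpha>\<^sub>0 \<mu> \<alpha>"
  shows "hom_Poisson_algebra scale \<mu>\<^sub>0 (\<lambda>x y. \<mu> 1 x y - \<mu> 1 y x) \<alpha>\<^sub>0"
proof -
  interpret commutative_hom_associative_algebra scale \<mu>\<^sub>0 \<alpha>\<^sub>0 by (rule assms(1))
  interpret formal_hom_associative_deformation scale \<mu>\<^sub>0 \<alpha>\<^sub>0 \<mu> \<alpha> by (rule assms(2))
  interpret twist: Vector_Spaces.linear scale scale \<alpha>\<^sub>0 by (rule linear_twist)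
  have comm: "\<mu> 0 x y = \<mu> 0 y x" for x y
    unfolding mult_0 by (rule mult_commute)
  show ?thesis
  proof
    show "bilinear_map scale (\<lambda>x y. \<mu> 1 x y - \<mu> 1 y x)"
      by (rule bilinear_map_commutator[OF bilinear_mult_term])
  next
    fix x y show "\<mu> 1 x y - \<mu> 1 y x = - (\<mu> 1 y x - \<mu> 1 x y)" by simp
  next
    fix x y z
    show "\<mu> 1 (\<alpha>\<^sub>0 x) (\<mu> 1 y z - \<mu> 1 z y) - \<mu> 1 (\<mu> 1 y z - \<mu> 1 z y) (\<alpha>\<^sub>0 x)
        + (\<mu> 1 (\<alpha>\<^sub>0 y) (\<mu> 1 z x - \<mu> 1 x z) - \<mu> 1 (\<mu> 1 z x - \<mu> 1 x z) (\<alpha>\<^sub>0 y))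
        + (\<mu> 1 (\<alpha>\<^sub>0 z) (\<mu> 1 x y - \<mu> 1 y x) - \<mu> 1 (\<mu> 1 x y - \<mu> 1 y x) (\<alpha>\<^sub>0 z)) = 0"
      using commutator_hom_Jacobi[OF comm] unfolding twist_0 .
    show "\<mu> 1 (\<alpha>\<^sub>0 x) (\<mu>\<^sub>0 y z) - \<mu> 1 (\<mu>\<^sub>0 y z) (\<alpha>\<^sub>0 x)
        = \<mu>\<^sub>0 (\<alpha>\<^sub>0 y) (\<mu> 1 x z - \<mu> 1 z x) + \<mu>\<^sub>0 (\<alpha>\<^sub>0 z) (\<mu> 1 x y - \<mu> 1 y x)"
      using commutator_hom_Leibniz[OF comm] unfolding twist_0 mult_0 .
  qed
qed

end
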